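(* Let $w=u_1\cdots u_n\in F(a,b)$ be a nontrivial cyclically reduced word over $\{a,a^{-1},b,b^{-1}\}$ (each $u_i$ a letter). Put \[ m_a=\#\{i:u_i\in\{a,a^{-1}\}\},\qquad m_b=\#\{i:u_i\in\{b,b^{-1}\}\},\qquad R=N_{ab}(w)+N_{b^{-1}a^{-1}}(w). \] Then the following hold. (1) The top homogeneous part of the trace polynomial $f_w$ is \[ [f_w]_{\rm top}=(-1)^{N_{ab}(w)+N_{ba}(w)}\, x^{m_a-R}y^{m_b-R}z^R. \] In particular, \[ \deg f_w=n-R =n-\tfrac{1}{2}\bigl(N_{ab}(w)+N_{ba}(w)+N_{a^{-1}b^{-1}}(w)+N_{b^{-1}a^{-1}}(w)\bigr). \] (2) Consequently, \[ \left\lceil \frac{n}{2}\right\rceil\le \deg f_w\le n, \] and, for every $n\ge 1$, both the lower and the upper bound are attained by some cyclically reduced word of length $n$.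
   Context: $F(a,b)$ is the free group on $a,b$. For $w\in F(a,b)$ and $A,B\in \mathrm{SL}(2,\mathbb C)$, $w(A,B)$ denotes the image of $w$ under the homomorphism $a\mapsto A$, $b\mapsto B$. The trace polynomial $f_w(x,y,z)\in\mathbb Z[x,y,z]$ of $w$ is the unique polynomial such that $\mathrm{Tr}(w(A,B))=f_w(\mathrm{Tr}A,\mathrm{Tr}B,\mathrm{Tr}(AB))$ for all $A,B\in \mathrm{SL}(2,\mathbb C)$ (its existence and uniqueness are classical). A word is cyclically reduced if it is freely reduced and its last letter is not the inverse of its first letter. For letters $r,s\in\{a,a^{-1},b,b^{-1}\}$, $N_{rs}(w)$ is the number of indices $i\in\{1,\dots,n\}$ with $u_i=r$ and $u_{i+1}=s$, indices read modulo $n$ (so $u_{n+1}=u_1$). $\deg$ is total degree, and $[f]_{\rm top}$ is the homogeneous component of $f$ of degree $\deg f$. *)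

theory Defs
  imports "HOL-Analysis.Analysis" "HOL-Library.Poly_Mapping"
begin

datatype letter = La | La_inv | Lb | Lb_inv

fun inv_letter :: "letter \<Rightarrow> letter" where
  "inv_letter La = La_inv"
| "inv_letter La_inv = La"
| "inv_letter Lb = Lb_inv"
| "inv_letter Lb_inv = Lb"

text \<open>Elements of \<open>F(a,b)\<close> are represented by freely reduced words, i.e. lists of
  letters; the empty list is the trivial element.\<close>

definition freely_reduced :: "letter list \<Rightarrow> bool" where
  "freely_reduced w \<longleftrightarrow> successively (\<lambda>r s. s \<noteq> inv_letter r) w"

definition cyclically_reduced :: "letter list \<Rightarrow> bool" where
  "cyclically_reduced w \<longleftrightarrow>
     freely_reduced w \<and> (w \<noteq> [] \<longrightarrow> last w \<noteq> inv_letter (hd w))"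

text \<open>Positions are numbered from 0, and the successor of the last position is 0.\<close>

definition cyc_count :: "letter \<Rightarrow> letter \<Rightarrow> letter list \<Rightarrow> nat" where
  "cyc_count r s w =
     card {i. i < length w \<and> w ! i = r \<and> w ! (Suc i mod length w) = s}"

definition letter_count :: "letter set \<Rightarrow> letter list \<Rightarrow> nat" where
  "letter_count S w = card {i. i < length w \<and> w ! i \<in> S}"

definition SL2C :: "(complex ^ 2 ^ 2) set" where
  "SL2C = {A. det A = 1}"

fun letter_eval ::
    "complex ^ 2 ^ 2 \<Rightarrow> complex ^ 2 ^ 2 \<Rightarrow> letter \<Rightarrow> complex ^ 2 ^ 2" where
  "letter_eval A B La = A"
| "letter_eval A B La_inv = matrix_inv A"
| "letter_eval A B Lb = B"
| "letter_eval A B Lb_inv = matrix_inv B"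

text \<open>The value at the word of the homomorphism from \<open>F(a,b)\<close> with \<open>a \<mapsto> A\<close>, \<open>b \<mapsto> B\<close>;
  \<open>matrix_inv\<close> is the group inverse because it is only used for \<open>A, B \<in> SL2C\<close>.\<close>

definition word_eval ::
    "complex ^ 2 ^ 2 \<Rightarrow> complex ^ 2 ^ 2 \<Rightarrow> letter list \<Rightarrow> complex ^ 2 ^ 2" where
  "word_eval A B w = foldr (\<lambda>u M. letter_eval A B u ** M) w (mat 1)"

datatype var = Vx | Vy | Vz

text \<open>Finitely supported coefficient functions on monomials, a monomial being a finitely
  supported exponent function; multiplication is convolution.\<close>

type_synonym poly3 = "(var \<Rightarrow>\<^sub>0 nat) \<Rightarrow>\<^sub>0 int"

definition pvar :: "var \<Rightarrow> poly3" where
  "pvar v = Poly_Mapping.single (Poly_Mapping.single v 1) 1"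

definition poly3_eval :: "poly3 \<Rightarrow> (var \<Rightarrow> complex) \<Rightarrow> complex" where
  "poly3_eval p c =
     (\<Sum>m\<in>Poly_Mapping.keys p. of_int (Poly_Mapping.lookup p m) *
        (\<Prod>v\<in>Poly_Mapping.keys m. c v ^ Poly_Mapping.lookup m v))"

definition monom_degree :: "(var \<Rightarrow>\<^sub>0 nat) \<Rightarrow> nat" where
  "monom_degree m = (\<Sum>v\<in>Poly_Mapping.keys m. Poly_Mapping.lookup m v)"

text \<open>The zero polynomial gets total degree 0.\<close>

definition total_degree :: "poly3 \<Rightarrow> nat" where
  "total_degree p = Max (insert 0 (monom_degree ` Poly_Mapping.keys p))"

definition homogeneous_component :: "nat \<Rightarrow> poly3 \<Rightarrow> poly3" where
  "homogeneous_component d p =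
     (\<Sum>m\<in>{m \<in> Poly_Mapping.keys p. monom_degree m = d}.
        Poly_Mapping.single m (Poly_Mapping.lookup p m))"

definition top_part :: "poly3 \<Rightarrow> poly3" where
  "top_part p = homogeneous_component (total_degree p) p"

definition is_trace_poly :: "letter list \<Rightarrow> poly3 \<Rightarrow> bool" where
  "is_trace_poly w f \<longleftrightarrow>
     (\<forall>A\<in>SL2C. \<forall>B\<in>SL2C. trace (word_eval A B w) =
        poly3_eval f (case_var (trace A) (trace B) (trace (A ** B))))"

text \<open>Existence and uniqueness of such a polynomial are classical (Fricke, Vogt).\<close>

definition trace_poly :: "letter list \<Rightarrow> poly3" where
  "trace_poly w = (THE f. is_trace_poly w f)"

end

theory Submission imports Defs begin

text \<open>
  By the Cayley-Hamilton theorem, all words in \<open>A\<close>, \<open>B\<close> lie in the span of \<open>1, A, B, AB\<close> over the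
  polynomials in the three traces, so a trace polynomial exists; it is unique because the three
  traces take arbitrary values.

  For the top part, take \<open>A = (t x, -1; 1, 0)\<close> and \<open>B = (0, t z; -1 / (t z), t y)\<close> with \<open>t = 1 / d\<close>,
  whose traces are \<open>t x\<close>, \<open>t y\<close> and \<open>t z + 1 / (t z)\<close>, and let \<open>t\<close> tend to infinity. Attach to each
  letter \<open>u\<close> a basis depending on \<open>d\<close>. In these bases, and after multiplication by \<open>d\<close>, the letter
  \<open>v\<close> following \<open>u\<close> equals a power of \<open>d\<close> times a matrix that converges to
  \<open>(g\<^sub>u\<^sub>v, 0; *, 0)\<close>. Hence \<open>d ^ (n - R)\<close> times the trace of the word
  tends to the product of the \<open>g\<^sub>u\<^sub>v\<close> over all cyclically adjacent pairs. This is the claimed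
  monomial, and its being nonzero identifies it as the top part.
\<close>

section \<open>Polynomials in three variables\<close>

lemma UNIV_var: "(UNIV :: var set) = {Vx, Vy, Vz}"
  using var.exhaust by auto

lemma finite_UNIV_var [simp]: "finite (UNIV :: var set)"
  by (simp add: UNIV_var)

abbreviation monom_val :: "(var \<Rightarrow> complex) \<Rightarrow> (var \<Rightarrow>\<^sub>0 nat) \<Rightarrow> complex" where
  "monom_val c m \<equiv> c Vx ^ Poly_Mapping.lookup m Vx * c Vy ^ Poly_Mapping.lookup m Vy * c Vz ^ Poly_Mapping.lookup m Vz"

lemma prod_keys_monom:
  "(\<Prod>v\<in>Poly_Mapping.keys m. c v ^ Poly_Mapping.lookup m v) = monom_val c m"
proof -
  have "(\<Prod>v\<in>Poly_Mapping.keys m. c v ^ Poly_Mapping.lookup m v) = (\<Prod>v\<in>UNIV. c v ^ Poly_Mapping.lookup m v)"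
    by (rule prod.mono_neutral_left) (auto simp: in_keys_iff)
  then show ?thesis by (simp add: UNIV_var mult.assoc)
qed

lemma monom_degree_eq: "monom_degree m = Poly_Mapping.lookup m Vx + Poly_Mapping.lookup m Vy + Poly_Mapping.lookup m Vz"
proof -
  have "monom_degree m = (\<Sum>v\<in>UNIV. Poly_Mapping.lookup m v)"
    unfolding monom_degree_def
    by (rule sum.mono_neutral_left) (auto simp: in_keys_iff)
  then show ?thesis by (simp add: UNIV_var)
qed

lemma poly3_eval_eq:
  "poly3_eval p c = (\<Sum>m\<in>Poly_Mapping.keys p. of_int (Poly_Mapping.lookup p m) * monom_val c m)"
  by (simp add: poly3_eval_def prod_keys_monom)

text \<open>Lets several polynomials be summed over one common index set, as additivity of
  evaluation requires.\<close>

lemma poly3_eval_superset: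
  assumes "finite S" "Poly_Mapping.keys p \<subseteq> S"
  shows "poly3_eval p c = (\<Sum>m\<in>S. of_int (Poly_Mapping.lookup p m) * monom_val c m)"
  unfolding poly3_eval_eq
  by (rule sum.mono_neutral_left) (use assms in \<open>auto simp: in_keys_iff\<close>)

lemma poly3_eval_zero [simp]: "poly3_eval 0 c = 0"
  by (simp add: poly3_eval_eq)

lemma poly3_eval_add [simp]: "poly3_eval (p + q) c = poly3_eval p c + poly3_eval q c"
  by (subst (1 2 3) poly3_eval_superset[where S = "Poly_Mapping.keys p \<union> Poly_Mapping.keys q"])
    (auto simp: lookup_add algebra_simps sum.distrib intro: keys_add[THEN subsetD, THEN UnE])

lemma poly3_eval_uminus [simp]: "poly3_eval (- p) c = - poly3_eval p c"
  using poly3_eval_add[of p "- p" c] by (simp add: eq_neg_iff_add_eq_0 add.commute)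

lemma poly3_eval_diff [simp]: "poly3_eval (p - q) c = poly3_eval p c - poly3_eval q c"
  using poly3_eval_add[of p "- q" c] by simp

lemma poly3_eval_sum: "poly3_eval (\<Sum>i\<in>I. p i) c = (\<Sum>i\<in>I. poly3_eval (p i) c)"
  by (induction I rule: infinite_finite_induct) auto

lemma poly3_eval_single [simp]:
  "poly3_eval (Poly_Mapping.single m k) c = of_int k * monom_val c m"
  by (subst poly3_eval_superset[where S = "{m}"]) auto

lemma poly3_sum_monomials: "(p :: poly3) = (\<Sum>m\<in>Poly_Mapping.keys p. Poly_Mapping.single m (Poly_Mapping.lookup p m))"
  by (rule poly_mapping_eqI)
    (auto simp: lookup_sum lookup_single when_def in_keys_iff)

lemma poly3_eval_mult [simp]: "poly3_eval (p * q) c = poly3_eval p c * poly3_eval q c"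
proof -
  have single: "poly3_eval (Poly_Mapping.single m k * Poly_Mapping.single m' k') c
      = poly3_eval (Poly_Mapping.single m k) c * poly3_eval (Poly_Mapping.single m' k') c"
    for m m' :: "var \<Rightarrow>\<^sub>0 nat" and k k' :: int
    by (simp add: mult_single lookup_add power_add mult_ac)
  \<comment> \<open>Expanding the factors and multiplying out leaves products of two monomials,
    settled by \<open>single\<close>. The left-hand side of \<open>poly3_sum_monomials\<close> is a
    bare variable, so the expansions are placed by occurrence number.\<close>
  show ?thesis
    by (subst (1 2) poly3_sum_monomials, subst (3) poly3_sum_monomials,
        subst (5) poly3_sum_monomials)
      (simp only: sum_product poly3_eval_sum single)
qed

lemma poly3_eval_one [simp]: "poly3_eval 1 c = 1"
  using poly3_eval_single[of 0 1 c] by simp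

lemma poly3_eval_power [simp]: "poly3_eval (p ^ k) c = poly3_eval p c ^ k"
  by (induction k) auto

lemma poly3_eval_pvar [simp]: "poly3_eval (pvar v) c = c v"
  by (cases v) (simp_all add: pvar_def lookup_single)

section \<open>Vanishing criterion and top part\<close>

lemma lookup_le_total_degree:
  assumes "m \<in> Poly_Mapping.keys p"
  shows "monom_degree m \<le> total_degree p"
  using assms by (auto simp: total_degree_def)

text \<open>Kronecker substitution: for \<open>N\<close> larger than all exponents, the substitution
  \<open>(s, s ^ N, s ^ N\<^sup>2)\<close> keeps distinct monomials distinct.\<close>

lemma poly3_zero_of_eval_zero:
  assumes zero: "\<And>c. (\<And>v. c v \<noteq> 0) \<Longrightarrow> poly3_eval p c = 0"
  shows "p = 0"
proof -
  define N where "N = Suc (total_degree p)"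
  define e where "e m = Poly_Mapping.lookup m Vx + N * (Poly_Mapping.lookup m Vy + N * Poly_Mapping.lookup m Vz)" for m :: "var \<Rightarrow>\<^sub>0 nat"
  have less_N: "Poly_Mapping.lookup m v < N" if "m \<in> Poly_Mapping.keys p" for m v
    using lookup_le_total_degree[OF that] by (cases v) (auto simp: N_def monom_degree_eq)
  have inj: "inj_on e (Poly_Mapping.keys p)"
  proof
    fix m m' assume m: "m \<in> Poly_Mapping.keys p" and m': "m' \<in> Poly_Mapping.keys p" and eq: "e m = e m'"
    \<comment> \<open>Uniqueness of division by \<open>N\<close> with remainder; two applications
      recover the exponents of \<open>m\<close> from \<open>e m\<close>.\<close>
    have split: "i = i' \<and> k = k'" if "i + N * k = i' + N * k'" "i < N" "i' < N" for i i' k k'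
    proof -
      have "(i + N * k) mod N = (i' + N * k') mod N" "(i + N * k) div N = (i' + N * k') div N"
        using that by simp_all
      then show ?thesis using that(2,3) by (simp add: div_add1_eq)
    qed
    note s1 = split[OF eq[unfolded e_def] less_N[OF m] less_N[OF m']]
    note s2 = split[OF conjunct2[OF s1] less_N[OF m] less_N[OF m']]
    show "m = m'"
    proof (rule poly_mapping_eqI)
      show "Poly_Mapping.lookup m v = Poly_Mapping.lookup m' v" for v using s1 s2 by (cases v) auto
    qed
  qed
  define P :: "complex poly" where "P = (\<Sum>m\<in>Poly_Mapping.keys p. monom (of_int (Poly_Mapping.lookup p m)) (e m))"
  have "poly P s = 0" if "s \<noteq> 0" for s
  proof -
    have "poly P s = poly3_eval p (case_var s (s ^ N) (s ^ (N * N)))"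
      unfolding P_def poly3_eval_eq poly_sum
      by (intro sum.cong)
        (simp_all add: poly_monom e_def power_add power_mult distrib_left mult.assoc)
    also have "\<dots> = 0"
      by (rule zero) (use that in \<open>auto split: var.split\<close>)
    finally show ?thesis .
  qed
  \<comment> \<open>The hypothesis covers only nonzero coordinates, hence only nonzero
    \<open>s\<close>, which still gives infinitely many roots.\<close>
  then have "UNIV - {0} \<subseteq> {s. poly P s = 0}" by auto
  then have "infinite {s. poly P s = 0}"
    using infinite_UNIV_char_0[where 'a = complex] finite_subset by fastforce
  then have "P = 0" using poly_roots_finite by blast
  have "Poly_Mapping.lookup p m = 0" for m
  proof (cases "m \<in> Poly_Mapping.keys p")
    case True
    \<comment> \<open>By injectivity of \<open>e\<close>, only \<open>m\<close> itself contributes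
      to this coefficient.\<close>
    have "coeff P (e m) = (\<Sum>m'\<in>Poly_Mapping.keys p. if m' = m then of_int (Poly_Mapping.lookup p m') else 0)"
      unfolding P_def coeff_sum
      by (intro sum.cong) (use inj True in \<open>auto dest: inj_onD\<close>)
    then show ?thesis using True \<open>P = 0\<close> by simp
  qed (simp add: in_keys_iff)
  then show ?thesis by (simp add: poly_mapping_eqI)
qed

text \<open>Points with nonzero coordinates suffice; the asymptotic computation below divides by x,
  y and z.\<close>

lemma poly3_eqI:
  assumes "\<And>c. (\<And>v. c v \<noteq> 0) \<Longrightarrow> poly3_eval p c = poly3_eval q c"
  shows "p = q"
  using poly3_zero_of_eval_zero[of "p - q"] assms by simp

lemma poly3_eval_top_part:
  "poly3_eval (top_part p) c =
     (\<Sum>m\<in>Poly_Mapping.keys p. if monom_degree m = total_degree p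
        then of_int (Poly_Mapping.lookup p m) * monom_val c m else 0)"
  by (simp add: top_part_def homogeneous_component_def poly3_eval_sum sum.If_cases Int_def)

text \<open>A positive maximum is not the inserted default 0, so some monomial attains it and keeps
  its nonzero coefficient in the top part.\<close>

lemma top_part_nonzero:
  assumes "total_degree p > 0"
  shows "top_part p \<noteq> 0"
proof -
  have "total_degree p \<in> insert 0 (monom_degree ` Poly_Mapping.keys p)"
    unfolding total_degree_def by (rule Max_in) auto
  then obtain m where m: "m \<in> Poly_Mapping.keys p" "monom_degree m = total_degree p"
    using assms by auto
  then have "Poly_Mapping.lookup (top_part p) m = Poly_Mapping.lookup p m"
    by (simp add: top_part_def homogeneous_component_def lookup_sum lookup_single when_def)
  then show ?thesis using m by (auto simp: in_keys_iff)
qed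

text \<open>The third coordinate \<open>h d\<close> may depend on \<open>d\<close> because the trace of \<open>AB\<close> will be \<open>u + 1 / u\<close>
  with \<open>u = z / d\<close>, which is not homogeneous in \<open>1 / d\<close>.\<close>

lemma top_part_limit:
  fixes h :: "real \<Rightarrow> complex"
  assumes "(h \<longlongrightarrow> z) (at_right 0)"
  shows "((\<lambda>d. of_real d ^ total_degree p *
            poly3_eval p (case_var (x / of_real d) (y / of_real d) (h d / of_real d)))
          \<longlongrightarrow> poly3_eval (top_part p) (case_var x y z)) (at_right 0)"
proof -
  let ?D = "total_degree p"
  \<comment> \<open>What remains of the summand of \<open>m\<close> after its powers of 1 / d are
    cancelled against \<open>d ^ ?D\<close>; the surplus power of d kills it in the limit unless
    \<open>m\<close> has top degree.\<close>
  let ?t = "\<lambda>m d. of_real d ^ (?D - monom_degree m) *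
    (of_int (Poly_Mapping.lookup p m) * monom_val (case_var x y (h d)) m)"
  have d0: "((\<lambda>d. of_real d :: complex) \<longlongrightarrow> 0) (at_right 0)"
    using tendsto_of_real[OF tendsto_ident_at, of 0 "{0<..}"] by simp
  have term_lim: "(?t m \<longlongrightarrow> (if monom_degree m = ?D
        then of_int (Poly_Mapping.lookup p m) * monom_val (case_var x y z) m else 0)) (at_right 0)"
    if "m \<in> Poly_Mapping.keys p" for m
  proof -
    have "(?t m \<longlongrightarrow> 0 ^ (?D - monom_degree m) *
        (of_int (Poly_Mapping.lookup p m) * monom_val (case_var x y z) m)) (at_right 0)"
      by (auto intro!: tendsto_mult tendsto_power d0 assms)
    then show ?thesis using lookup_le_total_degree[OF that] by (auto simp: power_0_left split: if_splits)
  qed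
  have "((\<lambda>d. \<Sum>m\<in>Poly_Mapping.keys p. ?t m d) \<longlongrightarrow> poly3_eval (top_part p) (case_var x y z)) (at_right 0)"
    unfolding poly3_eval_top_part by (intro tendsto_sum term_lim)
  moreover have "\<forall>\<^sub>F d in at_right 0. (\<Sum>m\<in>Poly_Mapping.keys p. ?t m d) = of_real d ^ ?D *
      poly3_eval p (case_var (x / of_real d) (y / of_real d) (h d / of_real d))"
  proof (rule eventually_at_right_less[THEN eventually_mono])
    fix d :: real assume d: "0 < d"
    show "(\<Sum>m\<in>Poly_Mapping.keys p. ?t m d) = of_real d ^ ?D *
      poly3_eval p (case_var (x / of_real d) (y / of_real d) (h d / of_real d))"
      unfolding poly3_eval_eq sum_distrib_left
    proof (rule sum.cong[OF refl])
      fix m assume m: "m \<in> Poly_Mapping.keys p"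
      have "(of_real d :: complex) ^ ?D = of_real d ^ (?D - monom_degree m) * of_real d ^ monom_degree m"
        using lookup_le_total_degree[OF m] by (simp flip: power_add)
      then show "?t m d = of_real d ^ ?D * (of_int (Poly_Mapping.lookup p m) *
          monom_val (case_var (x / of_real d) (y / of_real d) (h d / of_real d)) m)"
        using d by (simp add: monom_degree_eq power_add power_divide)
    qed
  qed
  ultimately show ?thesis by (rule Lim_transform_eventually)
qed

section \<open>Existence and uniqueness of the trace polynomial\<close>

definition mat2 :: "complex \<Rightarrow> complex \<Rightarrow> complex \<Rightarrow> complex \<Rightarrow> complex ^ 2 ^ 2" where
  "mat2 a b c d = vector [vector [a, b], vector [c, d]]"

lemma mat2_nth [simp]:
  "mat2 a b c d $ 1 $ 1 = a" "mat2 a b c d $ 1 $ 2 = b"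
  "mat2 a b c d $ 2 $ 1 = c" "mat2 a b c d $ 2 $ 2 = d"
  by (simp_all add: mat2_def)

lemma matrix2_eq_iff:
  fixes A B :: "complex ^ 2 ^ 2"
  shows "A = B \<longleftrightarrow> A $ 1 $ 1 = B $ 1 $ 1 \<and> A $ 1 $ 2 = B $ 1 $ 2 \<and>
    A $ 2 $ 1 = B $ 2 $ 1 \<and> A $ 2 $ 2 = B $ 2 $ 2"
  by (auto simp: vec_eq_iff forall_2)

lemma matrix2_mult_nth:
  fixes A B :: "complex ^ 2 ^ 2"
  shows "(A ** B) $ i $ j = A $ i $ 1 * B $ 1 $ j + A $ i $ 2 * B $ 2 $ j"
  by (simp add: matrix_matrix_mult_def sum_2)

lemma trace2:
  fixes A :: "complex ^ 2 ^ 2"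
  shows "trace A = A $ 1 $ 1 + A $ 2 $ 2"
  by (simp add: trace_def sum_2)

lemma mat_nth2:
  "(mat k :: complex ^ 2 ^ 2) $ 1 $ 1 = k" "(mat k :: complex ^ 2 ^ 2) $ 1 $ 2 = 0"
  "(mat k :: complex ^ 2 ^ 2) $ 2 $ 1 = 0" "(mat k :: complex ^ 2 ^ 2) $ 2 $ 2 = k"
  by (simp_all add: mat_def)

lemmas matrix2_simps = matrix2_eq_iff matrix2_mult_nth trace2 mat_nth2

text \<open>\<open>matrix_inv\<close> chooses some two-sided inverse; for square matrices a right
  inverse is two-sided, and two-sided inverses are unique.\<close>

lemma matrix_inv_eqI:
  fixes A B :: "complex ^ 2 ^ 2"
  assumes "A ** B = mat 1"
  shows "matrix_inv A = B"
proof -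
  have AB: "A ** B = mat 1 \<and> B ** A = mat 1"
    using assms matrix_left_right_inverse by blast
  then have "A ** matrix_inv A = mat 1 \<and> matrix_inv A ** A = mat 1"
    unfolding matrix_inv_def by (rule someI)
  then show ?thesis
    by (metis AB matrix_mul_assoc matrix_mul_lid matrix_mul_rid)
qed

text \<open>Cayley-Hamilton for determinant 1: A^2 - tr(A) A + 1 = 0.\<close>

lemma matrix_inv_SL2C:
  assumes "A \<in> SL2C"
  shows "matrix_inv A = mat (trace A) - A"
proof (rule matrix_inv_eqI)
  have det: "A $ 1 $ 1 * A $ 2 $ 2 - A $ 1 $ 2 * A $ 2 $ 1 = 1"
    using assms by (simp add: SL2C_def det_2)
  show "A ** (mat (trace A) - A) = mat 1"
    using det by (simp add: matrix2_simps algebra_simps)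
qed

lemma word_eval_simps [simp]:
  "word_eval A B [] = mat 1"
  "word_eval A B (u # w) = letter_eval A B u ** word_eval A B w"
  by (simp_all add: word_eval_def)

lemma word_eval_append: "word_eval A B (v @ w) = word_eval A B v ** word_eval A B w"
  by (induction v) (simp_all add: matrix_mul_assoc)

section \<open>Existence: reduction of words to the span of 1, A, B, AB\<close>

definition span4 ::
  "complex ^ 2 ^ 2 \<Rightarrow> complex ^ 2 ^ 2 \<Rightarrow> complex \<Rightarrow> complex \<Rightarrow> complex \<Rightarrow> complex \<Rightarrow> complex ^ 2 ^ 2"
  where "span4 A B p q r s = mat p + mat q ** A + mat r ** B + mat s ** (A ** B)"

lemma span4_nth:
  "span4 A B p q r s $ i $ j =
     mat p $ i $ j + q * A $ i $ j + r * B $ i $ j + s * (A $ i $ 1 * B $ 1 $ j + A $ i $ 2 * B $ 2 $ j)"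
  using exhaust_2[of i] by (auto simp: span4_def matrix2_simps algebra_simps)

lemma trace_span4:
  "trace (span4 A B p q r s) = 2 * p + q * trace A + r * trace B + s * trace (A ** B)"
  by (simp add: span4_nth matrix2_simps algebra_simps)

text \<open>The rules behind the coefficients are AA = xA - 1, the polarized Cayley-Hamilton
  identity BA = (z - xy) + yA + xB - AB, and BAB = zB + A - x, which is Cayley-Hamilton for AB
  multiplied by the inverse of A.\<close>

lemma mult_span4:
  assumes "A \<in> SL2C" "B \<in> SL2C"
  defines "x \<equiv> trace A" and "y \<equiv> trace B" and "z \<equiv> trace (A ** B)"
  shows "A ** span4 A B p q r s = span4 A B (- q) (p + x * q) (- s) (r + x * s)"
    and "B ** span4 A B p q r s =
      span4 A B ((z - x * y) * q - r - x * s) (y * q + s) (p + x * q + y * r + z * s) (- q)"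
proof -
  have detA: "A $ 1 $ 1 * A $ 2 $ 2 = 1 + A $ 1 $ 2 * A $ 2 $ 1"
   and detB: "B $ 1 $ 1 * B $ 2 $ 2 = 1 + B $ 1 $ 2 * B $ 2 $ 1"
    using assms(1,2) by (simp_all add: SL2C_def det_2 algebra_simps)
  show "A ** span4 A B p q r s = span4 A B (- q) (p + x * q) (- s) (r + x * s)"
    unfolding x_def using detA
    by (auto simp: span4_nth matrix2_simps; algebra)
  show "B ** span4 A B p q r s =
      span4 A B ((z - x * y) * q - r - x * s) (y * q + s) (p + x * q + y * r + z * s) (- q)"
    unfolding x_def y_def z_def using detA detB
    by (auto simp: span4_nth matrix2_simps; algebra)
qed

lemma mat_minus_mult_span4:
  "(mat k - C) ** span4 A B p q r s = span4 A B (k * p) (k * q) (k * r) (k * s) - C ** span4 A B p q r s"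
  by (simp add: span4_nth matrix2_simps algebra_simps)

lemma span4_diff:
  "span4 A B p q r s - span4 A B p' q' r' s' = span4 A B (p - p') (q - q') (r - r') (s - s')"
  by (simp add: span4_nth matrix2_simps algebra_simps)

text \<open>The coefficient polynomials are quantified before A and B: this uniformity is what turns
  the reduction into a trace polynomial.\<close>

lemma word_eval_span4:
  "\<exists>p q r s. \<forall>A\<in>SL2C. \<forall>B\<in>SL2C.
     let c = case_var (trace A) (trace B) (trace (A ** B)) in
     word_eval A B w = span4 A B (poly3_eval p c) (poly3_eval q c) (poly3_eval r c) (poly3_eval s c)"
proof (induction w)
  case Nil
  have "word_eval A B [] = span4 A B (poly3_eval 1 c) (poly3_eval 0 c) (poly3_eval 0 c) (poly3_eval 0 c)"
    for A B c by (simp add: span4_nth matrix2_simps)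
  then show ?case unfolding Let_def by blast
next
  case (Cons u w)
  then obtain p q r s where IH: "\<And>A B. A \<in> SL2C \<Longrightarrow> B \<in> SL2C \<Longrightarrow>
     let c = case_var (trace A) (trace B) (trace (A ** B)) in
     word_eval A B w = span4 A B (poly3_eval p c) (poly3_eval q c) (poly3_eval r c) (poly3_eval s c)"
    by blast
  let ?x = "pvar Vx" and ?y = "pvar Vy" and ?z = "pvar Vz"
  \<comment> \<open>\<open>?a\<close> and \<open>?b\<close> are the new coefficients after
    multiplication by A and B, read off from \<open>mult_span4\<close>. For the inverse letters, x -
    A and y - B replace A and B.\<close>
  let ?a = "(- q, p + ?x * q, - s, r + ?x * s)"
  let ?b = "((?z - ?x * ?y) * q - r - ?x * s, ?y * q + s, p + ?x * q + ?y * r + ?z * s, - q)"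
  obtain p' q' r' s' where new: "(p', q', r', s') =
      (case u of La \<Rightarrow> ?a | Lb \<Rightarrow> ?b
       | La_inv \<Rightarrow> (?x * p - fst ?a, ?x * q - fst (snd ?a), ?x * r - fst (snd (snd ?a)),
           ?x * s - snd (snd (snd ?a)))
       | Lb_inv \<Rightarrow> (?y * p - fst ?b, ?y * q - fst (snd ?b), ?y * r - fst (snd (snd ?b)),
           ?y * s - snd (snd (snd ?b))))"
    by (metis surj_pair)
  have "word_eval A B (u # w) =
      span4 A B (poly3_eval p' c) (poly3_eval q' c) (poly3_eval r' c) (poly3_eval s' c)"
    if AB: "A \<in> SL2C" "B \<in> SL2C" and c: "c = case_var (trace A) (trace B) (trace (A ** B))" for A B c
    using IH[OF AB] new unfolding Let_def c[symmetric]
    by (cases u)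
      (simp_all add: mult_span4[OF AB] matrix_inv_SL2C AB mat_minus_mult_span4 span4_diff c)
  then show ?case unfolding Let_def by blast
qed

lemma is_trace_poly_exists: "\<exists>f. is_trace_poly w f"
proof -
  obtain p q r s where *: "\<And>A B. A \<in> SL2C \<Longrightarrow> B \<in> SL2C \<Longrightarrow>
     let c = case_var (trace A) (trace B) (trace (A ** B)) in
     word_eval A B w = span4 A B (poly3_eval p c) (poly3_eval q c) (poly3_eval r c) (poly3_eval s c)"
    using word_eval_span4[of w] by blast
  have two: "poly3_eval 2 c = 2" for c
    using poly3_eval_add[of 1 1 c] by simp
  have "is_trace_poly w (2 * p + pvar Vx * q + pvar Vy * r + pvar Vz * s)"
    unfolding is_trace_poly_def using * by (simp add: Let_def trace_span4 two mult.commute)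
  then show ?thesis ..
qed

section \<open>Uniqueness: matrices with prescribed traces\<close>

definition matA :: "complex \<Rightarrow> complex ^ 2 ^ 2" where
  "matA x = mat2 x (- 1) 1 0"

text \<open>Together with \<open>matA x\<close> this realizes the traces x, y and u + 1 / u, so that
  all three can be prescribed; the same family, with its parameters divided by d, carries the
  asymptotics.\<close>

definition matB :: "complex \<Rightarrow> complex \<Rightarrow> complex ^ 2 ^ 2" where
  "matB y u = mat2 0 u (- 1 / u) y"

lemma matA_SL2C: "matA x \<in> SL2C"
  and matB_SL2C: "u \<noteq> 0 \<Longrightarrow> matB y u \<in> SL2C"
  by (simp_all add: matA_def matB_def SL2C_def det_2)

lemma trace_matA: "trace (matA x) = x"
  and trace_matB: "trace (matB y u) = y"
  and trace_matA_matB: "trace (matA x ** matB y u) = u + 1 / u"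
  by (simp_all add: matA_def matB_def matrix2_simps)

lemma is_trace_poly_unique:
  assumes "is_trace_poly w f" "is_trace_poly w g"
  shows "f = g"
proof (rule poly3_eqI)
  fix c :: "var \<Rightarrow> complex"
  \<comment> \<open>A root of u^2 - \<open>c Vz\<close> u + 1 = 0. It is nonzero since the two roots
    have product 1, and dividing by it gives u + 1 / u = \<open>c Vz\<close>.\<close>
  define u where "u = (c Vz + csqrt ((c Vz)\<^sup>2 - 4)) / 2"
  have "(c Vz + csqrt ((c Vz)\<^sup>2 - 4)) * (c Vz - csqrt ((c Vz)\<^sup>2 - 4)) = 4"
    using power2_csqrt[of "(c Vz)\<^sup>2 - 4"] by (simp add: algebra_simps power2_eq_square)
  then have u: "u * (c Vz - u) = 1" by (simp add: u_def field_simps)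
  then have "u \<noteq> 0" by auto
  have "u + 1 / u = c Vz" using u \<open>u \<noteq> 0\<close> by (simp add: field_simps)
  then have c: "case_var (trace (matA (c Vx))) (trace (matB (c Vy) u))
      (trace (matA (c Vx) ** matB (c Vy) u)) = c"
    by (auto simp: trace_matA trace_matB trace_matA_matB split: var.split)
  show "poly3_eval f c = poly3_eval g c"
    using assms matA_SL2C matB_SL2C[OF \<open>u \<noteq> 0\<close>] unfolding is_trace_poly_def by (metis c)
qed

lemma is_trace_poly_trace_poly: "is_trace_poly w (trace_poly w)"
  unfolding trace_poly_def using is_trace_poly_exists is_trace_poly_unique
  by (metis theI)

section \<open>The top homogeneous part\<close>

text \<open>The columns are the basis vectors. The letter keeps the second one bounded as d tends to
  0, although its matrix has entries of order 1 / d. Two of the bases degenerate at d = 0, but only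
  the transitions need a limit.\<close>

fun basis_change :: "complex \<Rightarrow> complex \<Rightarrow> complex \<Rightarrow> complex \<Rightarrow> letter \<Rightarrow> complex ^ 2 ^ 2" where
  "basis_change x y z d La = mat2 1 0 0 1"
| "basis_change x y z d La_inv = mat2 0 1 d (d / x)"
| "basis_change x y z d Lb = mat2 0 1 d 0"
| "basis_change x y z d Lb_inv = mat2 1 (z / y) 0 1"

text \<open>The matrix of the letter \<open>v\<close> following \<open>u\<close> in the bases attached to \<open>u\<close> and \<open>v\<close>, rescaled
  by a power of \<open>d\<close> (see \<open>shift\<close>) so as to have a limit for \<open>d \<rightarrow> 0\<close>. The bases are chosen such
  that all limits have second column 0. The last equation covers mutually inverse letters, which
  do not occur.\<close>

fun transition ::
  "complex \<Rightarrow> complex \<Rightarrow> complex \<Rightarrow> complex \<Rightarrow> letter \<Rightarrow> letter \<Rightarrow> complex ^ 2 ^ 2" where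
  "transition x y z d La La = mat2 x (- d) d 0"
| "transition x y z d La Lb = mat2 z 0 y (- d / z)"
| "transition x y z d La Lb_inv = mat2 y 0 (d\<^sup>2 / z) (d\<^sup>2 / y)"
| "transition x y z d Lb Lb = mat2 y (- d / z) (z * d) 0"
| "transition x y z d Lb La = mat2 1 0 x (- d)"
| "transition x y z d Lb La_inv = mat2 x 0 (d\<^sup>2) (d\<^sup>2 / x)"
| "transition x y z d La_inv La_inv = mat2 (x - d\<^sup>2 / x) (- d\<^sup>2 / x\<^sup>2) (d\<^sup>2) (d\<^sup>2 / x)"
| "transition x y z d La_inv Lb = mat2 (y - z * d / x) (- d / z) (z * d) 0"
| "transition x y z d La_inv Lb_inv = mat2 (d / z - y / x) (d / y) y 0"
| "transition x y z d Lb_inv Lb_inv =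
     mat2 (y - d\<^sup>2 / y) (- z * d\<^sup>2 / y\<^sup>2) (d\<^sup>2 / z) (d\<^sup>2 / y)"
| "transition x y z d Lb_inv La = mat2 (x - z * d / y) (- d) d 0"
| "transition x y z d Lb_inv La_inv = mat2 (d - z * x / y) (d / x) x 0"
| "transition x y z d _ _ = mat 0"

text \<open>Summed over the cyclically adjacent pairs this gives R, the amount by which the degree
  falls below n.\<close>

definition shift :: "letter \<Rightarrow> letter \<Rightarrow> nat" where
  "shift u v = (if u = La \<and> v = Lb then 1 else 0) + (if u = Lb_inv \<and> v = La_inv then 1 else 0)"

text \<open>The upper left entry of the limiting transition, factored so that its cyclic product
  splits into powers with letter and adjacency counts as exponents.\<close>

definition weight :: "complex \<Rightarrow> complex \<Rightarrow> complex \<Rightarrow> letter \<Rightarrow> letter \<Rightarrow> complex" where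
  "weight x y z u v =
     (if v \<in> {La, La_inv} then x else 1) * (if v \<in> {Lb, Lb_inv} then y else 1)
     * (if u = La \<and> v = Lb then z / y else 1) * (if u = Lb \<and> v = La then 1 / x else 1)
     * (if u = La_inv \<and> v = Lb_inv then - 1 / x else 1)
     * (if u = Lb_inv \<and> v = La_inv then - z / y else 1)"

lemma matrix_inv_mat2:
  assumes "a * d - b * c = 1"
  shows "matrix_inv (mat2 a b c d) = mat2 d (- b) (- c) a"
  by (rule matrix_inv_eqI) (use assms in \<open>simp add: matrix2_simps algebra_simps\<close>)

lemma scaleR_nth2: "(k *\<^sub>R (A :: complex ^ 2 ^ 2)) $ i $ j = of_real k * A $ i $ j"
  by (simp add: scaleR_conv_of_real[where 'a = complex])

lemma letter_eval_basis_change: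
  fixes d :: real
  assumes "x \<noteq> 0" "y \<noteq> 0" "z \<noteq> 0" "d \<noteq> 0" "v \<noteq> inv_letter u"
  defines "e \<equiv> complex_of_real d"
  shows "d *\<^sub>R (letter_eval (matA (x / e)) (matB (y / e) (z / e)) v ** basis_change x y z e v) =
    d ^ shift u v *\<^sub>R (basis_change x y z e u ** transition x y z e u v)"
proof -
  have "e \<noteq> 0" using \<open>d \<noteq> 0\<close> by (simp add: e_def)
  then show ?thesis
    using assms(1-3,5) unfolding e_def[symmetric]
    by (cases u; cases v)
      (simp_all add: matrix_inv_mat2 matA_def matB_def shift_def matrix2_simps scaleR_nth2
        field_simps power2_eq_square del: vector_scaleR_component flip: e_def)
qed

section \<open>Limits of transition products\<close>

lemma tendsto_mat2:
  assumes "(f \<longlongrightarrow> a) F" "(g \<longlongrightarrow> b) F" "(h \<longlongrightarrow> c) F" "(k \<longlongrightarrow> d) F"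
  shows "((\<lambda>t. mat2 (f t) (g t) (h t) (k t)) \<longlongrightarrow> mat2 a b c d) F"
proof (intro vec_tendstoI)
  show "((\<lambda>t. mat2 (f t) (g t) (h t) (k t) $ i $ j) \<longlongrightarrow> mat2 a b c d $ i $ j) F" for i j
    using exhaust_2[of i] exhaust_2[of j] assms by auto
qed

lemma tendsto_matrix_mult:
  fixes f g :: "'b \<Rightarrow> complex ^ 2 ^ 2"
  assumes "(f \<longlongrightarrow> a) F" "(g \<longlongrightarrow> b) F"
  shows "((\<lambda>t. f t ** g t) \<longlongrightarrow> a ** b) F"
  unfolding matrix_matrix_mult_def by (intro tendsto_intros assms)

text \<open>The entries are polynomials in d, so the limit is the value at d = 0.\<close>

lemma tendsto_transition:
  assumes "x \<noteq> 0" "y \<noteq> 0" "z \<noteq> 0"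
  shows "((\<lambda>d. transition x y z d u v) \<longlongrightarrow> transition x y z 0 u v) (at 0)"
  using assms by (cases u; cases v) (auto intro!: tendsto_mat2 tendsto_eq_intros)

fun transitions ::
  "complex \<Rightarrow> complex \<Rightarrow> complex \<Rightarrow> complex \<Rightarrow> letter \<Rightarrow> letter list \<Rightarrow> complex ^ 2 ^ 2" where
  "transitions x y z d u [] = mat 1"
| "transitions x y z d u (v # w) = transition x y z d u v ** transitions x y z d v w"

lemma tendsto_transitions:
  assumes "x \<noteq> 0" "y \<noteq> 0" "z \<noteq> 0"
  shows "((\<lambda>d. transitions x y z d u w) \<longlongrightarrow> transitions x y z 0 u w) (at 0)"
  by (induction w arbitrary: u) (auto intro!: tendsto_matrix_mult tendsto_transition assms)

abbreviation reduced_from :: "letter \<Rightarrow> letter list \<Rightarrow> bool" where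
  "reduced_from u w \<equiv> successively (\<lambda>r s. s \<noteq> inv_letter r) (u # w)"

lemma transition_0:
  assumes "x \<noteq> 0" "y \<noteq> 0" "v \<noteq> inv_letter u"
  shows "transition x y z 0 u v $ 1 $ 1 = weight x y z u v" "transition x y z 0 u v $ 1 $ 2 = 0"
    "transition x y z 0 u v $ 2 $ 2 = 0"
  using assms by (cases u; cases v; simp add: weight_def)+

text \<open>Matrices with zero second column are closed under products, and their upper left entries
  multiply. The empty product is the identity, whence the condition in the last claim.\<close>

lemma transitions_0:
  assumes "x \<noteq> 0" "y \<noteq> 0" "reduced_from u w"
  shows "transitions x y z 0 u w $ 1 $ 1 = (\<Prod>i<length w. weight x y z ((u # w) ! i) (w ! i))"
    and "transitions x y z 0 u w $ 1 $ 2 = 0"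
    and "w \<noteq> [] \<Longrightarrow> transitions x y z 0 u w $ 2 $ 2 = 0"
  using assms(3)
  by (induction w arbitrary: u)
    (simp_all add: matrix2_simps transition_0 assms prod.lessThan_Suc_shift del: prod.lessThan_Suc)

text \<open>Telescoping of \<open>letter_eval_basis_change\<close>: the basis attached to each
  letter links its transition to the next one.\<close>

lemma word_eval_basis_change:
  fixes d :: real
  assumes "x \<noteq> 0" "y \<noteq> 0" "z \<noteq> 0" "d \<noteq> 0" "reduced_from u w"
  defines "e \<equiv> complex_of_real d"
  shows "d ^ length w *\<^sub>R
      (word_eval (matA (x / e)) (matB (y / e) (z / e)) w ** basis_change x y z e (last (u # w))) =
    d ^ (\<Sum>i<length w. shift ((u # w) ! i) (w ! i)) *\<^sub>R
      (basis_change x y z e u ** transitions x y z e u w)"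
  using assms(5)
proof (induction w arbitrary: u)
  case Nil
  then show ?case by simp
next
  case (Cons v w)
  let ?L = "letter_eval (matA (x / e)) (matB (y / e) (z / e)) v"
  let ?W = "word_eval (matA (x / e)) (matB (y / e) (z / e)) w"
  let ?S = "\<Sum>i<length w. shift ((v # w) ! i) (w ! i)"
  have "d ^ length (v # w) *\<^sub>R (word_eval (matA (x / e)) (matB (y / e) (z / e)) (v # w)
      ** basis_change x y z e (last (u # v # w)))
    = d *\<^sub>R (?L ** (d ^ length w *\<^sub>R (?W ** basis_change x y z e (last (v # w)))))"
    by (simp add: matrix_scalar_ac matrix_mul_assoc flip: scalar_matrix_assoc)
  also have "\<dots> = d *\<^sub>R (?L ** (d ^ ?S *\<^sub>R (basis_change x y z e v ** transitions x y z e v w)))"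
    using Cons by simp
  also have "\<dots> = d ^ ?S *\<^sub>R ((d *\<^sub>R (?L ** basis_change x y z e v)) ** transitions x y z e v w)"
    by (simp add: matrix_scalar_ac matrix_mul_assoc mult.commute flip: scalar_matrix_assoc)
  also have "d *\<^sub>R (?L ** basis_change x y z e v) =
      d ^ shift u v *\<^sub>R (basis_change x y z e u ** transition x y z e u v)"
    unfolding e_def by (rule letter_eval_basis_change) (use assms(1-4) Cons.prems in auto)
  finally show ?case
    by (simp add: matrix_scalar_ac matrix_mul_assoc power_add mult.commute
      sum.lessThan_Suc_shift flip: scalar_matrix_assoc del: sum.lessThan_Suc)
qed

section \<open>Traces of cyclic words\<close>

lemma trace_scaleR: "trace (k *\<^sub>R (A :: complex ^ 2 ^ 2)) = of_real k * trace A"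
  by (simp only: trace2 scaleR_nth2 distrib_left)

lemma trace_eq_of_similar:
  fixes P Q G :: "complex ^ 2 ^ 2"
  assumes "P ** G = G ** Q" "det G \<noteq> 0"
  shows "trace P = trace Q"
proof -
  obtain H where H: "G ** H = mat 1"
    using assms(2) invertible_det_nz invertible_def by blast
  have "trace P = trace (P ** (G ** H))" by (simp add: H)
  also have "\<dots> = trace (H ** (G ** Q))" by (metis assms(1) matrix_mul_assoc trace_mul_sym)
  also have "\<dots> = trace Q" by (metis H matrix_left_right_inverse matrix_mul_assoc matrix_mul_lid)
  finally show ?thesis .
qed

lemma det_basis_change: "d \<noteq> 0 \<Longrightarrow> det (basis_change x y z d u) \<noteq> 0"
  by (cases u) (simp_all add: det_2)

lemma trace_word_eval_rotate1: "trace (word_eval A B (rotate1 w)) = trace (word_eval A B w)"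
  by (cases w) (simp_all add: word_eval_append trace_mul_sym[of "word_eval A B _"])

text \<open>\<open>hd w # rotate1 w\<close> is \<open>w\<close> with its first letter repeated at
  the end, so its linear adjacencies are the cyclic ones of \<open>w\<close>.\<close>

lemma cyclically_reduced_reduced_from:
  assumes "cyclically_reduced w" "w \<noteq> []"
  shows "reduced_from (hd w) (rotate1 w)"
proof -
  have "hd w # rotate1 w = w @ [hd w]" using assms(2) by (cases w) auto
  moreover have "inv_letter (inv_letter r) = r" for r by (cases r) auto
  ultimately show ?thesis
    using assms by (auto simp: cyclically_reduced_def freely_reduced_def successively_append_iff)
qed

abbreviation cyc_prod :: "(letter \<Rightarrow> letter \<Rightarrow> complex) \<Rightarrow> letter list \<Rightarrow> complex" where
  "cyc_prod g w \<equiv> \<Prod>i<length w. g (w ! i) (w ! (Suc i mod length w))"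

lemma nth_Cons_rotate1:
  assumes "i < length w"
  shows "(hd w # rotate1 w) ! i = w ! i"
proof -
  have "hd w # rotate1 w = w @ [hd w]" using assms by (cases w) auto
  then show ?thesis using assms by (simp add: nth_append)
qed

lemma trace_word_limit:
  assumes "cyclically_reduced w" "w \<noteq> []" "x \<noteq> 0" "y \<noteq> 0" "z \<noteq> 0"
  defines "s \<equiv> \<Sum>i<length w. shift (w ! i) (w ! (Suc i mod length w))"
  assumes "s \<le> length w"
  shows "((\<lambda>d. of_real d ^ (length w - s) * trace (word_eval (matA (x / of_real d))
      (matB (y / of_real d) (z / of_real d)) w)) \<longlongrightarrow> cyc_prod (weight x y z) w) (at_right 0)"
proof -
  let ?u = "hd w" and ?w = "rotate1 w"
  have red: "reduced_from ?u ?w" by (rule cyclically_reduced_reduced_from) fact+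
  \<comment> \<open>Initial and final basis coincide, so the change of basis is a conjugation and
    preserves the trace.\<close>
  have last: "last (?u # ?w) = ?u" using \<open>w \<noteq> []\<close> by (cases w) auto
  have s: "(\<Sum>i<length w. shift ((?u # ?w) ! i) (?w ! i)) = s"
    unfolding s_def by (intro sum.cong) (simp_all add: nth_Cons_rotate1 nth_rotate1 del: nth_Cons_0)
  have g: "(\<Prod>i<length w. weight x y z ((?u # ?w) ! i) (?w ! i)) = cyc_prod (weight x y z) w"
    by (intro prod.cong) (simp_all add: nth_Cons_rotate1 nth_rotate1)
  have "filterlim (\<lambda>d. complex_of_real d) (at 0) (at_right 0)"
    unfolding filterlim_at
    using tendsto_of_real[OF tendsto_ident_at, of 0 "{0<..}"]
    by (auto simp: eventually_at_filter)
  then have "((\<lambda>d. transitions x y z (of_real d) ?u ?w) \<longlongrightarrow> transitions x y z 0 ?u ?w) (at_right 0)"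
    by (rule filterlim_compose[OF tendsto_transitions[OF assms(3-5)]])
  then have "((\<lambda>d. trace (transitions x y z (of_real d) ?u ?w)) \<longlongrightarrow> trace (transitions x y z 0 ?u ?w))
      (at_right 0)"
    unfolding trace2 by (intro tendsto_intros)
  also have "trace (transitions x y z 0 ?u ?w) = cyc_prod (weight x y z) w"
    using \<open>w \<noteq> []\<close> by (simp add: trace2 transitions_0[OF assms(3,4) red] g)
  finally have lim: "((\<lambda>d. trace (transitions x y z (of_real d) ?u ?w)) \<longlongrightarrow> cyc_prod (weight x y z) w)
    (at_right 0)" .
  have "\<forall>\<^sub>F d in at_right 0. trace (transitions x y z (of_real d) ?u ?w) =
    of_real d ^ (length w - s) * trace (word_eval (matA (x / of_real d))
      (matB (y / of_real d) (z / of_real d)) w)"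
  proof (rule eventually_at_right_less[THEN eventually_mono])
    fix d :: real assume d: "0 < d"
    let ?e = "complex_of_real d"
    let ?W = "word_eval (matA (x / ?e)) (matB (y / ?e) (z / ?e))"
    have "d ^ length w *\<^sub>R (?W ?w ** basis_change x y z ?e ?u) =
        d ^ s *\<^sub>R (basis_change x y z ?e ?u ** transitions x y z ?e ?u ?w)"
      using word_eval_basis_change[OF assms(3-5) _ red, of d] d by (simp only: last s length_rotate1)
    then have "(d ^ length w *\<^sub>R ?W ?w) ** basis_change x y z ?e ?u =
        basis_change x y z ?e ?u ** (d ^ s *\<^sub>R transitions x y z ?e ?u ?w)"
      by (simp add: matrix_scalar_ac flip: scalar_matrix_assoc)
    then have "trace (d ^ length w *\<^sub>R ?W ?w) = trace (d ^ s *\<^sub>R transitions x y z ?e ?u ?w)"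
      by (rule trace_eq_of_similar) (use d det_basis_change in auto)
    then have "?e ^ length w * trace (?W w) = ?e ^ s * trace (transitions x y z ?e ?u ?w)"
      by (simp add: trace_scaleR trace_word_eval_rotate1)
    moreover have "?e ^ length w = ?e ^ s * ?e ^ (length w - s)"
      using \<open>s \<le> length w\<close> by (simp flip: power_add)
    ultimately show "trace (transitions x y z ?e ?u ?w) = ?e ^ (length w - s) * trace (?W w)"
      using d by simp
  qed
  with lim show ?thesis by (rule Lim_transform_eventually)
qed

section \<open>Counting cyclic adjacencies\<close>

lemma letter_count_sum: "letter_count S w = (\<Sum>i<length w. of_bool (w ! i \<in> S))"
  by (simp add: letter_count_def Int_def)

lemma cyc_count_sum:
  "cyc_count r s w = (\<Sum>i<length w. of_bool (w ! i = r \<and> w ! (Suc i mod length w) = s))"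
  by (simp add: cyc_count_def Int_def)

lemma bij_betw_cyc_Suc: "bij_betw (\<lambda>i. Suc i mod n) {..<n} {..<n}"
proof -
  have "inj_on (\<lambda>i. Suc i mod n) {..<n}"
    by (auto simp: inj_on_def mod_Suc split: if_splits)
  moreover have "(\<lambda>i. Suc i mod n) ` {..<n} \<subseteq> {..<n}"
    by auto
  ultimately show ?thesis
    by (simp add: bij_betw_def endo_inj_surj)
qed

lemma letter_count_successors:
  "letter_count {r} w = cyc_count r La w + cyc_count r La_inv w + cyc_count r Lb w + cyc_count r Lb_inv w"
  unfolding letter_count_sum cyc_count_sum sum.distrib[symmetric]
proof (intro sum.cong)
  fix i
  show "(of_bool (w ! i \<in> {r}) :: nat) = of_bool (w ! i = r \<and> w ! (Suc i mod length w) = La)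
    + of_bool (w ! i = r \<and> w ! (Suc i mod length w) = La_inv)
    + of_bool (w ! i = r \<and> w ! (Suc i mod length w) = Lb)
    + of_bool (w ! i = r \<and> w ! (Suc i mod length w) = Lb_inv)"
    by (cases "w ! (Suc i mod length w)") auto
qed simp

text \<open>The cyclic shift permutes the positions, so a letter may be counted at the successor
  position instead.\<close>

lemma letter_count_predecessors:
  "letter_count {s} w = cyc_count La s w + cyc_count La_inv s w + cyc_count Lb s w + cyc_count Lb_inv s w"
proof -
  have "letter_count {s} w = (\<Sum>i<length w. of_bool (w ! (Suc i mod length w) = s))"
    unfolding letter_count_sum
    by (subst sum.reindex_bij_betw[OF bij_betw_cyc_Suc, symmetric]) simp
  also have "\<dots> = cyc_count La s w + cyc_count La_inv s w + cyc_count Lb s w + cyc_count Lb_inv s w"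
    unfolding cyc_count_sum sum.distrib[symmetric]
  proof (intro sum.cong)
    fix i
    show "(of_bool (w ! (Suc i mod length w) = s) :: nat) =
        of_bool (w ! i = La \<and> w ! (Suc i mod length w) = s)
      + of_bool (w ! i = La_inv \<and> w ! (Suc i mod length w) = s)
      + of_bool (w ! i = Lb \<and> w ! (Suc i mod length w) = s)
      + of_bool (w ! i = Lb_inv \<and> w ! (Suc i mod length w) = s)"
      by (cases "w ! i") auto
  qed simp
  finally show ?thesis .
qed

lemma letter_count_pair:
  "r \<noteq> s \<Longrightarrow> letter_count {r, s} w = letter_count {r} w + letter_count {s} w"
  unfolding letter_count_sum sum.distrib[symmetric] by (intro sum.cong) auto

lemma letter_count_total: "letter_count {La, La_inv} w + letter_count {Lb, Lb_inv} w = length w"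
proof -
  have "letter_count {La, La_inv} w + letter_count {Lb, Lb_inv} w = (\<Sum>i<length w. 1)"
    unfolding letter_count_sum sum.distrib[symmetric]
  proof (intro sum.cong)
    show "of_bool (w ! i \<in> {La, La_inv}) + of_bool (w ! i \<in> {Lb, Lb_inv}) = (1 :: nat)" for i
      by (cases "w ! i") auto
  qed simp
  then show ?thesis by simp
qed

lemma cyc_count_inverse:
  assumes "cyclically_reduced w"
  shows "cyc_count r (inv_letter r) w = 0"
proof -
  have "w ! (Suc i mod length w) \<noteq> inv_letter (w ! i)" if "i < length w" for i
  proof -
    have "w \<noteq> []" using that by auto
    from cyclically_reduced_reduced_from[OF assms this] that
    have "(hd w # rotate1 w) ! Suc i \<noteq> inv_letter ((hd w # rotate1 w) ! i)"
      unfolding successively_conv_nth by (metis Suc_less_eq length_Cons length_rotate1)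
    then show ?thesis using that by (simp add: nth_Cons_rotate1 nth_rotate1)
  qed
  then show ?thesis by (auto simp: cyc_count_def)
qed

text \<open>In the cyclic word each letter has as many successors as predecessors; add the two balances
  for \<open>a\<close> and \<open>b\<^sup>-\<^sup>1\<close>.\<close>

lemma cyc_count_balance:
  assumes "cyclically_reduced w"
  shows "cyc_count La Lb w + cyc_count Lb_inv La_inv w =
    cyc_count Lb La w + cyc_count La_inv Lb_inv w"
  using letter_count_successors[of La w] letter_count_predecessors[of La w]
    letter_count_successors[of Lb_inv w] letter_count_predecessors[of Lb_inv w]
    cyc_count_inverse[OF assms, of La] cyc_count_inverse[OF assms, of La_inv]
    cyc_count_inverse[OF assms, of Lb] cyc_count_inverse[OF assms, of Lb_inv]
  by simp

text \<open>The pairs use \<open>La\<close> and \<open>Lb_inv\<close> only as first letters,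
  \<open>Lb\<close> and \<open>La_inv\<close> only as second letters, so no position serves two
  pairs.\<close>

lemma cyc_count_le_letter_count:
  "cyc_count La Lb w + cyc_count Lb_inv La_inv w \<le> letter_count {La, La_inv} w"
  "cyc_count La Lb w + cyc_count Lb_inv La_inv w \<le> letter_count {Lb, Lb_inv} w"
  using letter_count_successors[of La w] letter_count_predecessors[of La_inv w]
    letter_count_predecessors[of Lb w] letter_count_successors[of Lb_inv w]
  by (simp_all add: letter_count_pair)

section \<open>The limit as a monomial\<close>

lemma prod_if_power_sum:
  fixes k :: "'a :: comm_monoid_mult"
  shows "(\<Prod>i\<in>A. if P i then k else 1) = k ^ (\<Sum>i\<in>A. of_bool (P i))"
  by (induction A rule: infinite_finite_induct) auto

lemma cyc_prod_weight:
  assumes "x \<noteq> 0" "y \<noteq> 0" "cyclically_reduced w"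
  defines "R \<equiv> cyc_count La Lb w + cyc_count Lb_inv La_inv w"
  shows "cyc_prod (weight x y z) w = (- 1) ^ (cyc_count La Lb w + cyc_count Lb La w)
    * x ^ (letter_count {La, La_inv} w - R) * y ^ (letter_count {Lb, Lb_inv} w - R) * z ^ R"
proof -
  let ?ab = "cyc_count La Lb w" and ?ba = "cyc_count Lb La w"
  let ?ab' = "cyc_count La_inv Lb_inv w" and ?ba' = "cyc_count Lb_inv La_inv w"
  let ?ma = "letter_count {La, La_inv} w" and ?mb = "letter_count {Lb, Lb_inv} w"
  have reindex: "(\<Prod>i<length w. if w ! (Suc i mod length w) \<in> S then k else 1) = k ^ letter_count S w"
    for S and k :: complex
    unfolding letter_count_sum prod_if_power_sum[symmetric]
    by (rule prod.reindex_bij_betw[OF bij_betw_cyc_Suc])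
  have "cyc_prod (weight x y z) w = x ^ ?ma * y ^ ?mb * (z / y) ^ ?ab * (1 / x) ^ ?ba
      * (- 1 / x) ^ ?ab' * (- z / y) ^ ?ba'"
    unfolding weight_def prod.distrib reindex unfolding prod_if_power_sum cyc_count_sum ..
  also have "\<dots> = (- 1) ^ (?ab' + ?ba') * (x ^ ?ma / x ^ (?ba + ?ab')) * (y ^ ?mb / y ^ R) * z ^ R"
    by (simp add: R_def power_divide power_add power_minus[of "1 / x"] power_minus[of "z / y"] mult_ac)
  \<comment> \<open>By \<open>cyc_count_balance\<close> the exponent in the denominator is
    R.\<close>
  also have "x ^ ?ma / x ^ (?ba + ?ab') = x ^ (?ma - R)"
    using \<open>x \<noteq> 0\<close> cyc_count_le_letter_count(1)[of w] cyc_count_balance[OF assms(3)]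
    by (simp add: R_def power_diff)
  also have "y ^ ?mb / y ^ R = y ^ (?mb - R)"
    using \<open>y \<noteq> 0\<close> cyc_count_le_letter_count(2)[of w] by (simp add: R_def power_diff)
  \<comment> \<open>The two exponents agree modulo 2, again by the balance.\<close>
  also have "(- 1 :: complex) ^ (?ab' + ?ba') = (- 1) ^ (?ab + ?ba)"
  proof -
    have "even (?ab' + ?ba') \<longleftrightarrow> even (?ab + ?ba)"
      using arg_cong[OF cyc_count_balance[OF assms(3)], of even] by auto
    then show ?thesis by (simp add: minus_one_power_iff)
  qed
  finally show ?thesis .
qed

text \<open>The same trace, scaled by d^D and by d^E, has two finite limits: the top part and M.
  Neither vanishes identically, which forces D = E, and then the limits agree.\<close>

lemma top_part_trace_poly:
  assumes "cyclically_reduced w" "w \<noteq> []"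
  defines "R \<equiv> cyc_count La Lb w + cyc_count Lb_inv La_inv w"
  defines "M \<equiv> (- 1) ^ (cyc_count La Lb w + cyc_count Lb La w)
    * pvar Vx ^ (letter_count {La, La_inv} w - R) * pvar Vy ^ (letter_count {Lb, Lb_inv} w - R)
    * pvar Vz ^ R"
  shows "total_degree (trace_poly w) = length w - R" "top_part (trace_poly w) = M"
proof -
  let ?f = "trace_poly w"
  define D where "D = total_degree ?f"
  define E where "E = length w - R"
  define T where "T x y z d = trace (word_eval (matA (x / complex_of_real d))
    (matB (y / complex_of_real d) (z / complex_of_real d)) w)" for x y z d
  have lim_D: "((\<lambda>d. of_real d ^ D * T x y z d) \<longlongrightarrow> poly3_eval (top_part ?f) (case_var x y z))
      (at_right 0)" if "z \<noteq> 0" for x y z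
  proof -
    \<comment> \<open>The trace of AB is z / d + d / z = (z + d^2 / z) / d; this numerator is the
      \<open>h\<close> of \<open>top_part_limit\<close>.\<close>
    have "((\<lambda>d. z + complex_of_real d ^ 2 / z) \<longlongrightarrow> z + of_real 0 ^ 2 / z) (at_right 0)"
      by (intro tendsto_intros) (use that in auto)
    then have "((\<lambda>d. z + complex_of_real d ^ 2 / z) \<longlongrightarrow> z) (at_right 0)" by simp
    from top_part_limit[OF this, of ?f x y]
    show ?thesis unfolding D_def[symmetric]
    proof (rule Lim_transform_eventually)
      show "\<forall>\<^sub>F d in at_right 0. of_real d ^ D * poly3_eval ?f (case_var (x / of_real d)
          (y / of_real d) ((z + of_real d ^ 2 / z) / of_real d)) = of_real d ^ D * T x y z d"
      proof (rule eventually_at_right_less[THEN eventually_mono])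
        fix d :: real assume "0 < d"
        then have "z / complex_of_real d \<noteq> 0"
          and "(z + of_real d ^ 2 / z) / of_real d = z / of_real d + 1 / (z / complex_of_real d)"
          using that by (auto simp: field_simps power2_eq_square)
        then show "of_real d ^ D * poly3_eval ?f (case_var (x / of_real d)
          (y / of_real d) ((z + of_real d ^ 2 / z) / of_real d)) = of_real d ^ D * T x y z d"
          using is_trace_poly_trace_poly[of w] matA_SL2C matB_SL2C
          by (simp add: is_trace_poly_def T_def trace_matA trace_matB trace_matA_matB)
      qed
    qed
  qed
  have shift: "(\<Sum>i<length w. shift (w ! i) (w ! (Suc i mod length w))) = R"
    unfolding R_def cyc_count_sum sum.distrib[symmetric] by (intro sum.cong) (auto simp: shift_def)
  have R_le: "2 * R \<le> length w"
    using cyc_count_le_letter_count[of w] letter_count_total[of w] by (simp add: R_def)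
  have minus_one: "poly3_eval (- 1) c = - 1" for c
    by simp
  have M: "poly3_eval M (case_var x y z) = cyc_prod (weight x y z) w" if "x \<noteq> 0" "y \<noteq> 0" for x y z
    unfolding cyc_prod_weight[OF that assms(1)] M_def R_def by (simp only: poly3_eval_mult poly3_eval_power minus_one poly3_eval_pvar var.case)
  have lim_E: "((\<lambda>d. of_real d ^ E * T x y z d) \<longlongrightarrow> poly3_eval M (case_var x y z)) (at_right 0)"
    if "x \<noteq> 0" "y \<noteq> 0" "z \<noteq> 0" for x y z
    using trace_word_limit[OF assms(1,2) that] R_le
    by (simp add: M[OF that(1,2)] shift E_def T_def)
  \<comment> \<open>If scaling by d^i already yields a finite limit, any higher power of d yields
    the limit 0.\<close>
  have zero: "a = 0" if "i < j" "((\<lambda>d. of_real d ^ i * t d) \<longlongrightarrow> b) (at_right 0)"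
    "((\<lambda>d. of_real d ^ j * t d) \<longlongrightarrow> a) (at_right 0)" for i j a b and t :: "real \<Rightarrow> complex"
  proof -
    have "((\<lambda>d. of_real d ^ (j - i) * (of_real d ^ i * t d)) \<longlongrightarrow> of_real 0 ^ (j - i) * b) (at_right 0)"
      by (intro tendsto_intros that(2))
    moreover have "of_real d ^ (j - i) * (of_real d ^ i * t d) = of_real d ^ j * t d" for d
      using power_add[of "complex_of_real d" "j - i" i] that(1) by simp
    ultimately have "((\<lambda>d. of_real d ^ j * t d) \<longlongrightarrow> 0) (at_right 0)"
      using that(1) by (simp add: power_0_left)
    then show "a = 0" using that(3) tendsto_unique trivial_limit_at_right_real by blast
  qed
  have case_var: "case_var (c Vx) (c Vy) (c Vz) = c" for c :: "var \<Rightarrow> complex"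
    by (auto split: var.split)
  have "\<not> D < E"
  proof
    assume "D < E"
    \<comment> \<open>At (1, 1, 1) the monomial M is 1 or -1.\<close>
    then have "poly3_eval M (case_var 1 1 1) = 0"
      by (rule zero[OF _ lim_D lim_E]) auto
    then show False by (simp only: M_def poly3_eval_mult poly3_eval_power minus_one poly3_eval_pvar var.case) simp
  qed
  moreover have "\<not> E < D"
  proof
    assume "E < D"
    \<comment> \<open>This is absurd, because E < D makes the degree positive and
      \<open>top_part_nonzero\<close> applies.\<close>
    have "top_part ?f = 0"
    proof (rule poly3_zero_of_eval_zero)
      fix c :: "var \<Rightarrow> complex" assume "\<And>v. c v \<noteq> 0"
      then have "poly3_eval (top_part ?f) (case_var (c Vx) (c Vy) (c Vz)) = 0"
        by (intro zero[OF \<open>E < D\<close> lim_E lim_D])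
      then show "poly3_eval (top_part ?f) c = 0" by (simp only: case_var)
    qed
    then show False using top_part_nonzero[of ?f] \<open>E < D\<close> by (simp add: D_def)
  qed
  ultimately have "D = E" by simp
  then show "total_degree ?f = length w - R" by (simp add: D_def E_def)
  show "top_part ?f = M"
  proof (rule poly3_eqI)
    fix c :: "var \<Rightarrow> complex" assume c: "\<And>v. c v \<noteq> 0"
    have "poly3_eval (top_part ?f) (case_var (c Vx) (c Vy) (c Vz)) =
        poly3_eval M (case_var (c Vx) (c Vy) (c Vz))"
      using lim_D[OF c, unfolded \<open>D = E\<close>] lim_E[OF c c c] tendsto_unique trivial_limit_at_right_real
      by blast
    then show "poly3_eval (top_part ?f) c = poly3_eval M c" by (simp only: case_var)
  qed
qed

section \<open>Extremal words\<close>

lemma cyclically_reduced_positive: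
  assumes "set w \<subseteq> {La, Lb}"
  shows "cyclically_reduced w"
proof -
  have "s \<noteq> inv_letter r" if "r \<in> set w" "s \<in> set w" for r s
    using that assms by (cases r; cases s) auto
  then show ?thesis
    unfolding cyclically_reduced_def freely_reduced_def successively_conv_nth
    by (metis Suc_lessD hd_in_set last_in_set nth_mem)
qed

text \<open>Attains the lower bound: R takes its largest possible value, n div 2.\<close>

definition alternating :: "nat \<Rightarrow> letter list" where
  "alternating n = map (\<lambda>i. if even i then La else Lb) [0..<n]"

text \<open>The pairs start at the even positions, except that for odd n the last \<open>La\<close>
  is followed cyclically by the first one.\<close>

lemma cyc_count_alternating: "cyc_count La Lb (alternating n) = n div 2"
proof -
  have "{i. i < length (alternating n) \<and> alternating n ! i = La \<and>
      alternating n ! (Suc i mod length (alternating n)) = Lb} = (\<lambda>k. 2 * k) ` {..<n div 2}"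
    (is "?L = ?R")
  proof
    show "?L \<subseteq> ?R"
      by (auto simp: alternating_def mod_Suc elim!: evenE split: if_splits)
    show "?R \<subseteq> ?L"
      by (auto simp: alternating_def mod_Suc split: if_splits)
  qed
  then show ?thesis by (simp add: cyc_count_def card_image inj_on_def)
qed

lemma cyc_count_eq_0: "r \<notin> set w \<Longrightarrow> cyc_count r s w = 0"
  by (auto simp: cyc_count_def)

lemma total_degree_alternating:
  assumes "n \<ge> 1"
  shows "int (total_degree (trace_poly (alternating n))) = \<lceil>real n / 2\<rceil>"
proof -
  have "set (alternating n) \<subseteq> {La, Lb}" "length (alternating n) = n"
    by (auto simp: alternating_def)
  moreover from this have "alternating n \<noteq> []" "Lb_inv \<notin> set (alternating n)"
    using assms by auto
  ultimately have "total_degree (trace_poly (alternating n)) = n - n div 2"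
    by (simp add: top_part_trace_poly(1) cyclically_reduced_positive cyc_count_alternating
      cyc_count_eq_0)
  moreover have "\<lceil>real n / 2\<rceil> = int (n - n div 2)"
    by (rule ceiling_unique) linarith+
  ultimately show ?thesis by simp
qed

text \<open>Attains the upper bound, as R = 0.\<close>

lemma total_degree_power:
  assumes "n \<ge> 1"
  shows "total_degree (trace_poly (replicate n La)) = n"
proof -
  have "cyc_count La Lb (replicate n La) = 0" "cyc_count Lb_inv La_inv (replicate n La) = 0"
    by (auto simp: cyc_count_def)
  then show ?thesis
    using assms top_part_trace_poly(1)[OF cyclically_reduced_positive, of "replicate n La"] by auto
qed

theorem theorem1p1:
  shows
  "(\<forall>w :: letter list. w \<noteq> [] \<and> cyclically_reduced w \<longrightarrow>
      (let n = length w;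
           f = trace_poly w;
           m\<^sub>a = letter_count {La, La_inv} w;
           m\<^sub>b = letter_count {Lb, Lb_inv} w;
           R = cyc_count La Lb w + cyc_count Lb_inv La_inv w
       in R \<le> m\<^sub>a \<and> R \<le> m\<^sub>b
        \<and> top_part f =
            (-1) ^ (cyc_count La Lb w + cyc_count Lb La w)
            * pvar Vx ^ (m\<^sub>a - R) * pvar Vy ^ (m\<^sub>b - R) * pvar Vz ^ R
        \<and> int (total_degree f) = int n - int R
        \<and> real (total_degree f) =
            real n - 1 / 2 * real (cyc_count La Lb w + cyc_count Lb La w
              + cyc_count La_inv Lb_inv w + cyc_count Lb_inv La_inv w)
        \<and> \<lceil>real n / 2\<rceil> \<le> int (total_degree f)
        \<and> total_degree f \<le> n))
   \<and> (\<forall>n :: nat. n \<ge> 1 \<longrightarrow>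
        (\<exists>w. length w = n \<and> cyclically_reduced w
             \<and> int (total_degree (trace_poly w)) = \<lceil>real n / 2\<rceil>)
      \<and> (\<exists>w. length w = n \<and> cyclically_reduced w
             \<and> total_degree (trace_poly w) = n))"
proof (intro conjI allI impI)
  fix w :: "letter list"
  assume w: "w \<noteq> [] \<and> cyclically_reduced w"
  define R where "R = cyc_count La Lb w + cyc_count Lb_inv La_inv w"
  note top = top_part_trace_poly[OF conjunct2[OF w] conjunct1[OF w], folded R_def]
  note le = cyc_count_le_letter_count[of w, folded R_def]
  \<comment> \<open>R is at most each of the two letter counts, and these add up to n; this gives
    the lower bound for the degree.\<close>
  have R_le: "2 * R \<le> length w"
    using le letter_count_total[of w] by simp
  \<comment> \<open>By the balance, the four counts split into two pairs with sum R each.\<close>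
  have four: "cyc_count La Lb w + cyc_count Lb La w
      + cyc_count La_inv Lb_inv w + cyc_count Lb_inv La_inv w = 2 * R"
    using cyc_count_balance[of w] w by (simp add: R_def)
  have deg: "int (total_degree (trace_poly w)) = int (length w) - int R"
    using R_le top(1) by simp
  have half: "real (total_degree (trace_poly w)) = real (length w) - 1 / 2 * real (2 * R)"
    using R_le top(1) by (simp add: of_nat_diff)
  have lower: "\<lceil>real (length w) / 2\<rceil> \<le> int (total_degree (trace_poly w))"
    using R_le by (simp add: deg ceiling_le_iff)
  have upper: "total_degree (trace_poly w) \<le> length w"
    using top(1) by simp
  show "let n = length w;
           f = trace_poly w;
           m\<^sub>a = letter_count {La, La_inv} w;
           m\<^sub>b = letter_count {Lb, Lb_inv} w;
           R = cyc_count La Lb w + cyc_count Lb_inv La_inv w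
       in R \<le> m\<^sub>a \<and> R \<le> m\<^sub>b
        \<and> top_part f =
            (-1) ^ (cyc_count La Lb w + cyc_count Lb La w)
            * pvar Vx ^ (m\<^sub>a - R) * pvar Vy ^ (m\<^sub>b - R) * pvar Vz ^ R
        \<and> int (total_degree f) = int n - int R
        \<and> real (total_degree f) =
            real n - 1 / 2 * real (cyc_count La Lb w + cyc_count Lb La w
              + cyc_count La_inv Lb_inv w + cyc_count Lb_inv La_inv w)
        \<and> \<lceil>real n / 2\<rceil> \<le> int (total_degree f)
        \<and> total_degree f \<le> n"
    unfolding Let_def four R_def[symmetric] by (intro conjI le top(2) deg half lower upper)
next
  fix n :: nat assume n: "n \<ge> 1"
  have "length (alternating n) = n" "cyclically_reduced (alternating n)"
    by (auto intro!: cyclically_reduced_positive simp: alternating_def)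
  then show "\<exists>w. length w = n \<and> cyclically_reduced w
      \<and> int (total_degree (trace_poly w)) = \<lceil>real n / 2\<rceil>"
    using total_degree_alternating[OF n] by blast
  have "length (replicate n La) = n" "cyclically_reduced (replicate n La)"
    by (auto intro!: cyclically_reduced_positive)
  then show "\<exists>w. length w = n \<and> cyclically_reduced w \<and> total_degree (trace_poly w) = n"
    using total_degree_power[OF n] by blast
qed

end
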